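(* Let $0\le\alpha<1$ and let $p\ge q\ge2$ and $n$ be integers with $p+q\le n-1$. Let $B^4_{n,p,q}=B^2_{n,p,q}-\{(v_n,v_{p+q})\}+\{(v_n,v_{p+1})\}$. Then $\lambda_\alpha(B^4_{n,p,q})>\lambda_\alpha(B^2_{n,p,q})$.
   Context: All digraphs are simple. For a digraph $G$, $A(G)$ is its adjacency matrix and $D(G)$ the diagonal matrix of outdegrees; $A_\alpha(G)=\alpha D(G)+(1-\alpha)A(G)$ and $\lambda_\alpha(G)$ is the largest modulus of an eigenvalue of $A_\alpha(G)$. $\overleftrightarrow{K_{p,q}}$ is the complete bipartite digraph obtained from $K_{p,q}$ by replacing each edge with a pair of opposite arcs, with parts $V_p=\{v_1,\ldots,v_p\}$ and $V_q=\{v_{p+1},\ldots,v_{p+q}\}$; let $v_{p+q+1},\ldots,v_n$ be new vertices. $B^2_{n,p,q}$ is obtained from $\overleftrightarrow{K_{p,q}}$ by adding the directed path $v_{p+1}v_{p+q+1}v_{p+q+2}\cdots v_nv_{p+q}$. $G-\{e\}+\{f\}$ denotes deleting arc $e$ and adding arc $f$. *)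

theory Defs
  imports "Graph_Theory.Digraph" "Jordan_Normal_Form.Spectral_Radius"
begin

text \<open>
  Rows and columns are indexed by the vertices in increasing order; another order would only
  conjugate the matrices by a permutation matrix.
\<close>

definition vertex_list :: "('a :: linorder, 'b) pre_digraph \<Rightarrow> 'a list" where
  "vertex_list G = sorted_list_of_set (verts G)"

definition adj_matrix :: "('a :: linorder, 'b) pre_digraph \<Rightarrow> real mat" where
  "adj_matrix G =
     mat (card (verts G)) (card (verts G))
       (\<lambda>(i, j). if vertex_list G ! i \<rightarrow>\<^bsub>G\<^esub> vertex_list G ! j then 1 else 0)"

definition outdeg_matrix :: "('a :: linorder, 'b) pre_digraph \<Rightarrow> real mat" where
  "outdeg_matrix G =
     mat (card (verts G)) (card (verts G))
       (\<lambda>(i, j). if i = j then real (out_degree G (vertex_list G ! i)) else 0)"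

definition A_alpha :: "real \<Rightarrow> ('a :: linorder, 'b) pre_digraph \<Rightarrow> real mat" where
  "A_alpha \<alpha> G = \<alpha> \<cdot>\<^sub>m outdeg_matrix G + (1 - \<alpha>) \<cdot>\<^sub>m adj_matrix G"

definition lambda_alpha :: "real \<Rightarrow> ('a :: linorder, 'b) pre_digraph \<Rightarrow> real" where
  "lambda_alpha \<alpha> G = spectral_radius (map_mat complex_of_real (A_alpha \<alpha> G))"

text \<open>The vertex \<open>v\<^sub>i\<close> is the natural number \<open>i\<close>, and the arc from \<open>u\<close> to \<open>v\<close> is the pair \<open>(u, v)\<close>.\<close>

definition complete_bipartite_digraph :: "nat \<Rightarrow> nat \<Rightarrow> (nat, nat \<times> nat) pre_digraph" where
  "complete_bipartite_digraph p q =
     \<lparr> verts = {1..p + q},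
       arcs = {1..p} \<times> {p + 1..p + q} \<union> {p + 1..p + q} \<times> {1..p},
       tail = fst, head = snd \<rparr>"

definition add_path :: "'a list \<Rightarrow> ('a, 'a \<times> 'a) pre_digraph \<Rightarrow> ('a, 'a \<times> 'a) pre_digraph" where
  "add_path vs G = G\<lparr> verts := verts G \<union> set vs, arcs := arcs G \<union> set (zip vs (tl vs)) \<rparr>"

definition B2 :: "nat \<Rightarrow> nat \<Rightarrow> nat \<Rightarrow> (nat, nat \<times> nat) pre_digraph" where
  "B2 n p q =
     add_path ([p + 1] @ [p + q + 1..<n + 1] @ [p + q]) (complete_bipartite_digraph p q)"

definition B4 :: "nat \<Rightarrow> nat \<Rightarrow> nat \<Rightarrow> (nat, nat \<times> nat) pre_digraph" where
  "B4 n p q = pre_digraph.add_arc (pre_digraph.del_arc (B2 n p q) (n, p + q)) (n, p + 1)"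

end

theory Submission
  imports Defs
begin

text \<open>
  Both digraphs are the same up to the last vertex \<open>e\<close> of the added path, and an eigenvector for
  \<open>x\<close> can be written down: \<open>a\<close> on \<open>V\<^sub>p\<close>, \<open>c\<close> at \<open>v\<^sub>p\<^sub>+\<^sub>1\<close>, \<open>1\<close> on the rest of \<open>V\<^sub>q\<close>, and a geometric
  progression with ratio \<open>t = (1 - \<alpha>) / (x - \<alpha>)\<close> along the path, ending in the value \<open>s\<close> at \<open>e\<close>.
  All rows but that of \<open>v\<^sub>p\<^sub>+\<^sub>1\<close> determine \<open>a\<close> and \<open>c\<close> as functions of \<open>x\<close>; the remaining row is a
  scalar equation \<open>F x s = 0\<close>, with \<open>s = 1\<close> for \<open>B2\<close> and \<open>s = c x\<close> for \<open>B4\<close>.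
  For \<open>B2\<close> there is a root \<open>x\<close> beyond the zero of \<open>c\<close>; its eigenvector is positive, so \<open>x\<close> bounds the
  spectral radius. Subtracting the rows of \<open>v\<^sub>p\<^sub>+\<^sub>1\<close> and \<open>v\<^sub>p\<^sub>+\<^sub>q\<close> gives \<open>c x > 1\<close>, hence
  \<open>F x (c x) < F x 1 = 0\<close>, and the equation for \<open>B4\<close> has a root larger than \<open>x\<close>.
\<close>

section \<open>Bounding the spectral radius by real test vectors\<close>

text \<open>Collatz-Wielandt argument: take an eigenvector \<open>v\<close> for an eigenvalue of
  largest modulus and an index \<open>i\<close> maximizing \<open>cmod (v $ i) / x i\<close>. The
  triangle inequality in row \<open>i\<close> compares \<open>v\<close> with \<open>m * x\<close>,
  where \<open>m\<close> is that maximum, and equality at \<open>i\<close> lets the factor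
  \<open>m * x i\<close> cancel.\<close>

lemma spectral_radius_le_of_positive_supersolution:
  fixes A :: "real mat" and x :: "nat \<Rightarrow> real"
  assumes A: "A \<in> carrier_mat n n" and "n > 0"
    and nonneg: "\<And>i j. i < n \<Longrightarrow> j < n \<Longrightarrow> 0 \<le> A $$ (i, j)"
    and pos: "\<And>i. i < n \<Longrightarrow> 0 < x i"
    and super: "\<And>i. i < n \<Longrightarrow> (\<Sum>j<n. A $$ (i, j) * x j) \<le> \<rho> * x i"
  shows "spectral_radius (map_mat complex_of_real A) \<le> \<rho>"
proof -
  let ?C = "map_mat complex_of_real A"
  have C: "?C \<in> carrier_mat n n" using A by simp
  obtain k where k: "spectral_radius ?C = cmod k" "eigenvalue ?C k"
    using spectral_radius_mem_max(1)[OF C \<open>n > 0\<close>] by (auto simp: spectrum_def)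
  then obtain v where v: "v \<in> carrier_vec n" "v \<noteq> 0\<^sub>v n" "?C *\<^sub>v v = k \<cdot>\<^sub>v v"
    using A unfolding eigenvalue_def eigenvector_def by auto
  define r where "r i = cmod (v $ i) / x i" for i
  define m where "m = Max (r ` {..<n})"
  have fin: "finite (r ` {..<n})" and ne: "r ` {..<n} \<noteq> {}" using \<open>n > 0\<close> by auto
  obtain i where i: "i < n" "m = r i"
    using Max_in[OF fin ne] by (auto simp: m_def)
  have le_m: "cmod (v $ j) \<le> m * x j" if "j < n" for j
  proof -
    have "r j \<le> m" using that fin by (simp add: m_def)
    then show ?thesis using pos[OF that] by (simp add: r_def field_simps)
  qed
  have "\<exists>j<n. v $ j \<noteq> 0"
  proof (rule ccontr)
    assume "\<not> (\<exists>j<n. v $ j \<noteq> 0)"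
    then have "v = 0\<^sub>v n" using v(1) by (intro eq_vecI) auto
    then show False using v(2) by simp
  qed
  then obtain j0 where j0: "j0 < n" "v $ j0 \<noteq> 0" by blast
  \<comment> \<open>A nonzero entry of \<open>v\<close> forces \<open>m > 0\<close>, which the final
    cancellation requires.\<close>
  have "0 < m * x j0" using le_m[OF j0(1)] j0(2)
    by (meson less_le_trans zero_less_norm_iff)
  then have m0: "0 < m" using pos[OF j0(1)] by (simp add: zero_less_mult_iff)
  have vi: "cmod (v $ i) = m * x i" using i(2) pos[OF i(1)] by (simp add: r_def)
  have "k * v $ i = (\<Sum>j<n. complex_of_real (A $$ (i, j)) * v $ j)"
  proof -
    have "k * v $ i = (k \<cdot>\<^sub>v v) $ i" using i v(1) by simp
    also have "\<dots> = (?C *\<^sub>v v) $ i" using v(3) by simp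
    also have "\<dots> = (\<Sum>j<n. complex_of_real (A $$ (i, j)) * v $ j)"
      using i(1) A v(1) by (auto simp: scalar_prod_def lessThan_atLeast0 intro!: sum.cong)
    finally show ?thesis .
  qed
  then have "cmod k * cmod (v $ i) = cmod (\<Sum>j<n. complex_of_real (A $$ (i, j)) * v $ j)"
    by (metis norm_mult)
  also have "\<dots> \<le> (\<Sum>j<n. A $$ (i, j) * (m * x j))"
    using nonneg[OF i(1)] le_m by (intro sum_norm_le) (auto simp: norm_mult intro!: mult_left_mono)
  also have "\<dots> = m * (\<Sum>j<n. A $$ (i, j) * x j)"
    by (simp add: sum_distrib_left algebra_simps)
  also have "\<dots> \<le> m * (\<rho> * x i)" using super[OF i(1)] m0 by simp
  finally have "cmod k * (m * x i) \<le> \<rho> * (m * x i)" by (simp add: vi algebra_simps)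
  then show ?thesis using m0 pos[OF i(1)] k(1) by simp
qed

lemma spectral_radius_ge_of_real_eigenvector:
  fixes A :: "real mat" and x :: "nat \<Rightarrow> real"
  assumes A: "A \<in> carrier_mat n n"
    and eig: "\<And>i. i < n \<Longrightarrow> (\<Sum>j<n. A $$ (i, j) * x j) = \<rho> * x i"
    and nz: "k < n" "x k \<noteq> 0"
  shows "\<rho> \<le> spectral_radius (map_mat complex_of_real A)"
proof -
  let ?C = "map_mat complex_of_real A"
  let ?v = "vec n (\<lambda>i. complex_of_real (x i))"
  have C: "?C \<in> carrier_mat n n" using A by simp
  have "?v $ k \<noteq> 0\<^sub>v n $ k" using nz by simp
  then have "?v \<noteq> 0\<^sub>v n" by metis
  moreover have "?C *\<^sub>v ?v = complex_of_real \<rho> \<cdot>\<^sub>v ?v"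
  proof (rule eq_vecI)
    fix i assume "i < dim_vec (complex_of_real \<rho> \<cdot>\<^sub>v ?v)"
    then have i: "i < n" by simp
    have "(?C *\<^sub>v ?v) $ i = complex_of_real (\<Sum>j<n. A $$ (i, j) * x j)"
      using i A by (auto simp: scalar_prod_def lessThan_atLeast0 intro!: sum.cong)
    then show "(?C *\<^sub>v ?v) $ i = (complex_of_real \<rho> \<cdot>\<^sub>v ?v) $ i"
      using i eig[OF i] by simp
  qed (use A in simp)
  ultimately have "eigenvalue ?C (complex_of_real \<rho>)"
    using A unfolding eigenvalue_def eigenvector_def by (intro exI[of _ ?v]) auto
  then have "cmod (complex_of_real \<rho>) \<le> spectral_radius ?C"
    using nz
    by (intro spectral_radius_mem_max(2)[OF C] imageI) (auto simp: spectrum_def)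
  then show ?thesis by simp
qed

section \<open>Eigenvalue equations as sums over out-neighbours\<close>

lemma A_alpha_carrier [simp]: "A_alpha \<alpha> G \<in> carrier_mat (card (verts G)) (card (verts G))"
  by (simp add: A_alpha_def outdeg_matrix_def adj_matrix_def)

lemma bij_betw_vertex_list:
  assumes "finite (verts G)"
  shows "bij_betw ((!) (vertex_list G)) {..<card (verts G)} (verts G)"
  using assms by (intro bij_betw_nth) (auto simp: vertex_list_def)

text \<open>Reindexing along the vertex enumeration removes the matrix positions, so that
  eigenvectors can be given as functions on vertices.\<close>

lemma A_alpha_row_sum:
  assumes fin: "finite (verts G)" and i: "i < card (verts G)"
    and u: "u = vertex_list G ! i"
  shows "(\<Sum>j<card (verts G). A_alpha \<alpha> G $$ (i, j) * f (vertex_list G ! j)) =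
    \<alpha> * real (out_degree G u) * f u + (1 - \<alpha>) * (\<Sum>w | w \<in> verts G \<and> u \<rightarrow>\<^bsub>G\<^esub> w. f w)"
proof -
  let ?N = "card (verts G)" and ?v = "(!) (vertex_list G)"
  have "(\<Sum>j<?N. A_alpha \<alpha> G $$ (i, j) * f (?v j)) =
      (\<Sum>j<?N. (if i = j then \<alpha> * real (out_degree G u) * f u else 0)
        + (1 - \<alpha>) * (if u \<rightarrow>\<^bsub>G\<^esub> ?v j then f (?v j) else 0))"
    using i by (intro sum.cong)
      (auto simp: A_alpha_def outdeg_matrix_def adj_matrix_def u algebra_simps)
  also have "\<dots> = \<alpha> * real (out_degree G u) * f u
      + (1 - \<alpha>) * (\<Sum>j<?N. if u \<rightarrow>\<^bsub>G\<^esub> ?v j then f (?v j) else 0)"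
    using i by (simp add: sum.distrib sum_distrib_left)
  also have "(\<Sum>j<?N. if u \<rightarrow>\<^bsub>G\<^esub> ?v j then f (?v j) else 0) =
      (\<Sum>w\<in>verts G. if u \<rightarrow>\<^bsub>G\<^esub> w then f w else 0)"
    by (rule sum.reindex_bij_betw[OF bij_betw_vertex_list[OF fin]])
  also have "\<dots> = (\<Sum>w | w \<in> verts G \<and> u \<rightarrow>\<^bsub>G\<^esub> w. f w)"
    using fin by (simp add: sum.inter_filter)
  finally show ?thesis .
qed

lemma lambda_alpha_le:
  assumes fin: "finite (verts G)" and ne: "verts G \<noteq> {}" and \<alpha>: "0 \<le> \<alpha>" "\<alpha> \<le> 1"
    and pos: "\<And>u. u \<in> verts G \<Longrightarrow> 0 < f u"
    and super: "\<And>u. u \<in> verts G \<Longrightarrow>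
      \<alpha> * real (out_degree G u) * f u + (1 - \<alpha>) * (\<Sum>w | w \<in> verts G \<and> u \<rightarrow>\<^bsub>G\<^esub> w. f w) \<le> \<rho> * f u"
  shows "lambda_alpha \<alpha> G \<le> \<rho>"
  unfolding lambda_alpha_def
proof (rule spectral_radius_le_of_positive_supersolution[where n = "card (verts G)"
      and x = "\<lambda>i. f (vertex_list G ! i)"])
  have mem: "vertex_list G ! i \<in> verts G" if "i < card (verts G)" for i
    using bij_betw_apply[OF bij_betw_vertex_list[OF fin]] that by auto
  show "0 < card (verts G)" using fin ne by (simp add: card_gt_0_iff)
  show "0 < f (vertex_list G ! i)" if "i < card (verts G)" for i using pos mem that by blast
  show "0 \<le> A_alpha \<alpha> G $$ (i, j)" if "i < card (verts G)" "j < card (verts G)" for i j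
    using that \<alpha> by (simp add: A_alpha_def outdeg_matrix_def adj_matrix_def)
  show "(\<Sum>j<card (verts G). A_alpha \<alpha> G $$ (i, j) * f (vertex_list G ! j))
      \<le> \<rho> * f (vertex_list G ! i)" if "i < card (verts G)" for i
    using super[OF mem[OF that]] A_alpha_row_sum[OF fin that refl] by simp
qed simp

lemma lambda_alpha_ge:
  assumes fin: "finite (verts G)" and z: "z \<in> verts G" "f z \<noteq> 0"
    and eig: "\<And>u. u \<in> verts G \<Longrightarrow>
      \<alpha> * real (out_degree G u) * f u + (1 - \<alpha>) * (\<Sum>w | w \<in> verts G \<and> u \<rightarrow>\<^bsub>G\<^esub> w. f w) = \<rho> * f u"
  shows "\<rho> \<le> lambda_alpha \<alpha> G"
proof -
  note bij = bij_betw_vertex_list[OF fin]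
  obtain k where k: "k < card (verts G)" "z = vertex_list G ! k"
    using bij_betw_imp_surj_on[OF bij] z(1) by blast
  show ?thesis unfolding lambda_alpha_def
  proof (rule spectral_radius_ge_of_real_eigenvector[where n = "card (verts G)"
        and x = "\<lambda>i. f (vertex_list G ! i)"])
    show "(\<Sum>j<card (verts G). A_alpha \<alpha> G $$ (i, j) * f (vertex_list G ! j))
        = \<rho> * f (vertex_list G ! i)" if "i < card (verts G)" for i
    proof -
      have "vertex_list G ! i \<in> verts G" using bij_betw_apply[OF bij] that by auto
      from eig[OF this] A_alpha_row_sum[OF fin that refl] show ?thesis by simp
    qed
  qed (use k z in auto)
qed

section \<open>A common form of the two digraphs\<close>

text \<open>The head \<open>e\<close> of the last path arc is a parameter: \<open>p + q\<close>
  gives \<open>B2\<close> and \<open>p + 1\<close> gives \<open>B4\<close>, so one eigenvector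
  computation serves both.\<close>

definition B_end :: "nat \<Rightarrow> nat \<Rightarrow> nat \<Rightarrow> nat \<Rightarrow> (nat, nat \<times> nat) pre_digraph" where
  "B_end n p q e =
     \<lparr> verts = {1..n},
       arcs = {1..p} \<times> {p + 1..p + q} \<union> {p + 1..p + q} \<times> {1..p} \<union> {(p + 1, p + q + 1)}
         \<union> {(i, i + 1) | i. p + q < i \<and> i < n} \<union> {(n, e)},
       tail = fst, head = snd \<rparr>"

lemma set_zip_upt_snoc:
  assumes "m \<le> n"
  shows "set (zip [m..<Suc n] (tl [m..<Suc n] @ [b])) = {(i, i + 1) | i. m \<le> i \<and> i < n} \<union> {(n, b)}"
  using assms
proof (induction m rule: inc_induct)
  case base
  then show ?case by auto
next
  case (step m)
  have e1: "[m..<Suc n] = m # [Suc m..<Suc n]" and e2: "[Suc m..<Suc n] = Suc m # tl [Suc m..<Suc n]"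
    using step.hyps by (simp_all add: upt_conv_Cons del: upt_Suc)
  have "zip [m..<Suc n] (tl [m..<Suc n] @ [b]) =
      (m, Suc m) # zip [Suc m..<Suc n] (tl [Suc m..<Suc n] @ [b])"
    by (subst (1 2) e1, subst (2) e2) simp
  then show ?case using step by (auto simp del: upt_Suc)
qed

lemma B2_eq_B_end:
  assumes "2 \<le> q" "p + q < n"
  shows "B2 n p q = B_end n p q (p + q)"
proof -
  let ?m = "p + q + 1"
  have e: "[?m..<Suc n] = ?m # tl [?m..<Suc n]"
    using assms by (simp add: upt_conv_Cons del: upt_Suc)
  have zip_step: "zip ([x] @ (y # ys) @ [z]) (tl ([x] @ (y # ys) @ [z])) =
      (x, y) # zip ((y # ys) @ [z]) (tl (y # ys) @ [z])" for x y z :: nat and ys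
    by simp
  have "zip ([p + 1] @ [?m..<Suc n] @ [p + q]) (tl ([p + 1] @ [?m..<Suc n] @ [p + q])) =
      (p + 1, ?m) # zip ([?m..<Suc n] @ [p + q]) (tl [?m..<Suc n] @ [p + q])"
    using zip_step[of "p + 1" ?m "tl [?m..<Suc n]" "p + q"] unfolding e[symmetric] .
  \<comment> \<open>The first list is longer by one, so its last entry \<open>p + q\<close> has no
    partner and drops out.\<close>
  also have "zip ([?m..<Suc n] @ [p + q]) (tl [?m..<Suc n] @ [p + q]) =
      zip [?m..<Suc n] (tl [?m..<Suc n] @ [p + q])"
    using assms by (subst zip_append1) (simp del: upt_Suc)
  finally have zip_eq: "zip ([p + 1] @ [?m..<Suc n] @ [p + q]) (tl ([p + 1] @ [?m..<Suc n] @ [p + q])) =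
      (p + 1, ?m) # zip [?m..<Suc n] (tl [?m..<Suc n] @ [p + q])" .
  have "?m \<le> n" using assms by simp
  then have arcs_eq: "set (zip ([p + 1] @ [?m..<Suc n] @ [p + q]) (tl ([p + 1] @ [?m..<Suc n] @ [p + q])))
      = insert (p + 1, ?m) ({(i, i + 1) | i. ?m \<le> i \<and> i < n} \<union> {(n, p + q)})"
    unfolding zip_eq list.set(2) by (simp only: set_zip_upt_snoc)
  have verts_eq: "{1..p + q} \<union> set ([p + 1] @ [?m..<Suc n] @ [p + q]) = {1..n}"
    using assms by auto
  have "verts (B2 n p q) = {1..n}"
    unfolding B2_def add_path_def complete_bipartite_digraph_def Suc_eq_plus1[symmetric]
    using verts_eq by (simp del: upt_Suc)
  moreover have "arcs (B2 n p q) = arcs (B_end n p q (p + q))"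
  proof -
    have "arcs (B2 n p q) = {1..p} \<times> {p + 1..p + q} \<union> {p + 1..p + q} \<times> {1..p}
        \<union> insert (p + 1, ?m) ({(i, i + 1) | i. ?m \<le> i \<and> i < n} \<union> {(n, p + q)})"
      unfolding arcs_eq[symmetric]
      by (simp add: B2_def add_path_def complete_bipartite_digraph_def del: upt_Suc)
    also have "\<dots> = arcs (B_end n p q (p + q))"
      by (simp add: B_end_def Suc_le_eq Un_assoc insert_commute)
    finally show ?thesis .
  qed
  moreover have "tail (B2 n p q) = fst" "head (B2 n p q) = snd"
    by (simp_all add: B2_def add_path_def complete_bipartite_digraph_def)
  ultimately show ?thesis
    by (intro pre_digraph.equality) (simp_all add: B_end_def)
qed

text \<open>Since \<open>n > p + q\<close>, the deleted arc coincides with no other arc, and both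
  ends of the new arc are already vertices.\<close>

lemma B4_eq_B_end:
  assumes "2 \<le> q" "p + q < n"
  shows "B4 n p q = B_end n p q (p + 1)"
  unfolding B4_def B2_eq_B_end[OF assms] B_end_def pre_digraph.add_arc_def pre_digraph.del_arc_def
  using assms by auto

lemma B_end_successors:
  "{w \<in> verts (B_end n p q e). u \<rightarrow>\<^bsub>B_end n p q e\<^esub> w} = arcs (B_end n p q e) `` {u} \<inter> {1..n}"
  by (auto simp: B_end_def arcs_ends_def arc_to_ends_def image_iff)

lemma B_end_out_degree: "out_degree (B_end n p q e) u = card (arcs (B_end n p q e) `` {u})"
proof -
  have "out_arcs (B_end n p q e) u = Pair u ` (arcs (B_end n p q e) `` {u})"
    by (auto simp: B_end_def out_arcs_def)
  then show ?thesis by (simp add: out_degree_def card_image inj_on_def)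
qed

section \<open>The explicit eigenvector\<close>

text \<open>The exponent counts the arcs from the path vertex \<open>u\<close> to the end of the
  path, where the value is \<open>s\<close>; thus \<open>n\<close> itself carries
  \<open>t * s\<close>.\<close>

definition B_end_vector :: "nat \<Rightarrow> nat \<Rightarrow> nat \<Rightarrow> real \<Rightarrow> real \<Rightarrow> real \<Rightarrow> real \<Rightarrow> nat \<Rightarrow> real" where
  "B_end_vector n p q a c t s u =
     (if u \<le> p then a else if u = p + 1 then c else if u \<le> p + q then 1 else t ^ (n + 1 - u) * s)"

text \<open>The four equations are the rows of \<open>V_p\<close>, of \<open>V_q\<close> without
  \<open>p + 1\<close>, of \<open>p + 1\<close>, and of a path vertex. The condition on
  \<open>e\<close> and \<open>s\<close> says that \<open>s\<close> is the entry at
  \<open>e\<close>.\<close>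

lemma B_end_eigenvector:
  fixes \<alpha> \<rho> a c t s :: real
  assumes q: "2 \<le> q" and n: "p + q < n" and e: "e = p + q \<and> s = 1 \<or> e = p + 1 \<and> s = c"
    and eq_a: "\<alpha> * q * a + (1 - \<alpha>) * (q - 1 + c) = \<rho> * a"
    and eq_1: "\<alpha> * p + (1 - \<alpha>) * (p * a) = \<rho>"
    and eq_c: "\<alpha> * (p + 1) * c + (1 - \<alpha>) * (p * a + t ^ (n - p - q) * s) = \<rho> * c"
    and eq_t: "\<alpha> * t + (1 - \<alpha>) = \<rho> * t"
    and u: "u \<in> verts (B_end n p q e)"
  defines "G \<equiv> B_end n p q e" and "f \<equiv> B_end_vector n p q a c t s"
  shows "\<alpha> * real (out_degree G u) * f u + (1 - \<alpha>) * (\<Sum>w | w \<in> verts G \<and> u \<rightarrow>\<^bsub>G\<^esub> w. f w) = \<rho> * f u"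
proof -
  have u1: "1 \<le> u" "u \<le> n" using u by (auto simp: B_end_def)
  have goal: ?thesis if "arcs G `` {u} = S" "S \<subseteq> {1..n}"
    "\<alpha> * card S * f u + (1 - \<alpha>) * sum f S = \<rho> * f u" for S
  proof -
    have "{w \<in> verts G. u \<rightarrow>\<^bsub>G\<^esub> w} = S"
      using that(1,2) unfolding G_def B_end_successors by blast
    moreover have "out_degree G u = card S" using that(1) unfolding G_def B_end_out_degree by simp
    ultimately show ?thesis using that(3) by simp
  qed
  have sum_p: "sum f {1..p} = p * a" by (simp add: f_def B_end_vector_def)
  have fe: "f e = s" using e q by (auto simp: f_def B_end_vector_def)
  consider "u \<le> p" | "u = p + 1" | "p + 1 < u" "u \<le> p + q" | "p + q < u" "u < n" | "u = n"
    using u1 by linarith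
  then show ?thesis
  proof cases
    case 1
    have "{p + 1..p + q} = insert (p + 1) {p + 2..p + q}" using q by auto
    then have "sum f {p + 1..p + q} = c + sum f {p + 2..p + q}" by (simp add: f_def B_end_vector_def)
    also have "sum f {p + 2..p + q} = (\<Sum>w\<in>{p + 2..p + q}. 1)"
      by (rule sum.cong) (auto simp: f_def B_end_vector_def)
    also have "\<dots> = real q - 1" using q by (simp add: of_nat_diff)
    finally have "sum f {p + 1..p + q} = real q - 1 + c" by simp
    moreover have "f u = a" using 1 by (simp add: f_def B_end_vector_def)
    moreover have "arcs G `` {u} = {p + 1..p + q}" using 1 u1 n by (auto simp: G_def B_end_def)
    ultimately show ?thesis using eq_a n by (intro goal[of "{p + 1..p + q}"]) auto
  next
    case 2
    \<comment> \<open>The start vertex has one out-neighbour beyond \<open>V_p\<close>, the first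
      path vertex; hence the outdegree \<open>p + 1\<close> and the power of \<open>t\<close> in
      \<open>eq_c\<close>.\<close>
    have "f (p + q + 1) = t ^ (n - p - q) * s" using q by (simp add: f_def B_end_vector_def)
    then have "sum f (insert (p + q + 1) {1..p}) = p * a + t ^ (n - p - q) * s"
      using sum_p by simp
    moreover have "f u = c" using 2 by (simp add: f_def B_end_vector_def)
    moreover have "arcs G `` {u} = insert (p + q + 1) {1..p}"
      using 2 u1 n q by (auto simp: G_def B_end_def)
    moreover have "real (card (insert (p + q + 1) {1..p})) = real p + 1" by simp
    moreover have "insert (p + q + 1) {1..p} \<subseteq> {1..n}" using n by auto
    ultimately show ?thesis using eq_c goal[of "insert (p + q + 1) {1..p}"] by (simp only:)
  next
    case 3
    have "f u = 1" using 3 by (simp add: f_def B_end_vector_def)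
    moreover have "arcs G `` {u} = {1..p}" using 3 u1 n by (auto simp: G_def B_end_def)
    ultimately show ?thesis using eq_1 n sum_p by (intro goal[of "{1..p}"]) auto
  next
    case 4
    have f_path: "f v = t ^ (n + 1 - v) * s" if "p + q < v" for v
      using that q by (simp add: f_def B_end_vector_def)
    have "n + 1 - u = Suc (n + 1 - (u + 1))" using 4 by linarith
    then have "t ^ (n + 1 - u) * s = t * (t ^ (n + 1 - (u + 1)) * s)"
      by (metis power_Suc mult.assoc)
    also have "\<dots> = t * f (u + 1)" using f_path[of "u + 1"] 4 by simp
    finally have "f u = t * f (u + 1)" using f_path[OF 4(1)] by (rule trans[rotated])
    moreover have "arcs G `` {u} = {u + 1}" using 4 u1 n q by (auto simp: G_def B_end_def)
    moreover have "\<alpha> * (t * f (u + 1)) + (1 - \<alpha>) * f (u + 1) = \<rho> * (t * f (u + 1))"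
      using arg_cong[OF eq_t, of "\<lambda>z. z * f (u + 1)"] by (simp add: algebra_simps)
    moreover have "real (card {u + 1}) = 1" "sum f {u + 1} = f (u + 1)" by simp_all
    moreover have "{u + 1} \<subseteq> {1..n}" using 4 by auto
    ultimately show ?thesis using goal[of "{u + 1}"] by (simp only: mult_1_right)
  next
    case 5
    have "f u = t * s" using n q by (simp add: 5 f_def B_end_vector_def)
    moreover have "arcs G `` {u} = {e}" using n q by (auto simp: 5 G_def B_end_def)
    moreover have "\<alpha> * (t * s) + (1 - \<alpha>) * s = \<rho> * (t * s)"
      using arg_cong[OF eq_t, of "\<lambda>z. z * s"] by (simp add: algebra_simps)
    moreover have "real (card {e}) = 1" "sum f {e} = s" using fe by simp_all
    moreover have "{e} \<subseteq> {1..n}" using e n q by auto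
    ultimately show ?thesis using goal[of "{e}"] by (simp only: mult_1_right)
  qed
qed

section \<open>Comparing the roots of the two scalar equations\<close>

theorem theorem4p6:
  fixes \<alpha> :: real and n p q :: nat
  assumes "0 \<le> \<alpha>" and "\<alpha> < 1"
    and "q \<le> p" and "2 \<le> q" and "p + q \<le> n - 1"
  shows "lambda_alpha \<alpha> (B4 n p q) > lambda_alpha \<alpha> (B2 n p q)"
proof -
  note \<alpha> = assms(1,2)
  have n: "p + q < n" and p: "2 \<le> p" using assms by auto
  define k where "k = n - p - q"
  \<comment> \<open>\<open>a\<close> solves \<open>eq_1\<close>, then \<open>c\<close> solves
    \<open>eq_a\<close>, and \<open>t\<close> solves \<open>eq_t\<close>. \<open>F x s\<close> is
    the defect in the row of \<open>p + 1\<close>, with \<open>(1 - \<alpha>) * p * a x\<close>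
    replaced by \<open>x - \<alpha> * p\<close>. \<open>L\<close> is a crude right end for the
    intermediate value theorem.\<close>
  define a where "a x = (x - \<alpha> * p) / ((1 - \<alpha>) * p)" for x
  define c where "c x = (x - \<alpha> * q) * a x / (1 - \<alpha>) - (real q - 1)" for x
  define t where "t x = (1 - \<alpha>) / (x - \<alpha>)" for x
  define F where "F x s = (x - \<alpha> * (real p + 1)) * c x - (x - \<alpha> * p) - (1 - \<alpha>) * (t x ^ k * s)" for x s
  define L where "L = 4 * real p + 4"
  have eq_a: "\<alpha> * q * a x + (1 - \<alpha>) * (real q - 1 + c x) = x * a x" for x
    using \<alpha> by (simp add: c_def field_simps)
  have eq_1: "\<alpha> * p + (1 - \<alpha>) * (p * a x) = x" for x
    using \<alpha> p by (simp add: a_def)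
  have eq_t: "\<alpha> * t x + (1 - \<alpha>) = x * t x" if "\<alpha> < x" for x
    using that by (simp add: t_def field_simps)
  have eq_c: "\<alpha> * (real p + 1) * c x + (1 - \<alpha>) * (p * a x + t x ^ k * s) = x * c x" if "F x s = 0" for x s
    using that eq_1[of x] by (simp add: F_def algebra_simps)
  have \<alpha>p: "\<alpha> \<le> \<alpha> * p" "\<alpha> * q \<le> \<alpha> * p" "\<alpha> * p \<le> p"
    using \<alpha> p assms(3) by (auto intro: mult_left_mono simp: mult_left_le_one_le mult_le_cancel_left1)
  have a_pos: "0 < a x" if "\<alpha> * p < x" for x using that \<alpha> p by (simp add: a_def)

  have cL: "2 \<le> c L"
  proof -
    have "3 \<le> a L"
    proof -
      have "3 * ((1 - \<alpha>) * p) \<le> L - \<alpha> * p" using \<alpha>p \<alpha> by (simp add: L_def algebra_simps)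
      then show ?thesis using \<alpha> p by (simp add: a_def field_simps)
    qed
    moreover have "3 * real p * (1 - \<alpha>) \<le> L - \<alpha> * q" using \<alpha>p \<alpha> by (simp add: L_def algebra_simps)
    then have "3 * real p \<le> (L - \<alpha> * q) / (1 - \<alpha>)" using \<alpha> by (simp add: field_simps)
    ultimately have "3 * real p * 3 \<le> (L - \<alpha> * q) / (1 - \<alpha>) * a L"
      by (intro mult_mono) auto
    then show ?thesis using assms(3) p by (simp add: c_def)
  qed
  have tL: "0 \<le> t L ^ k" "t L ^ k \<le> 1"
    using \<alpha> by (auto simp: t_def L_def intro!: power_le_one)
  \<comment> \<open>Both choices of \<open>s\<close> are at most \<open>c L\<close>, so
    \<open>F L s\<close> is at least
    \<open>(L - \<alpha> * (p + 1) - 1) * c L - (L - \<alpha> * p)\<close>, and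
    \<open>c L \<ge> 2\<close> makes this positive.\<close>
  have FL: "0 < F L s" if "s = 1 \<or> s = c L" for s
  proof -
    have "s \<le> c L" "0 \<le> s" using that cL by auto
    then have "t L ^ k * s \<le> c L" using tL
      by (meson mult_left_le_one_le order_trans)
    then have "(1 - \<alpha>) * (t L ^ k * s) \<le> 1 * c L"
      using \<alpha> tL \<open>0 \<le> s\<close> by (intro mult_mono) auto
    moreover have "(L - \<alpha> * (real p + 1) - 1) * 2 \<le> (L - \<alpha> * (real p + 1) - 1) * c L"
      using cL \<alpha>p \<alpha> by (intro mult_left_mono) (auto simp: L_def algebra_simps)
    moreover have "L - \<alpha> * p < (L - \<alpha> * (real p + 1) - 1) * 2"
    proof -
      have distrib: "\<alpha> * (real p + 1) = \<alpha> * p + \<alpha>" by (simp add: algebra_simps)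
      have "4 * z + 4 - w < (4 * z + 4 - (w + \<alpha>) - 1) * 2" if "w \<le> z" "0 \<le> z" for w z
        using that \<alpha>(2) by argo
      then show ?thesis unfolding L_def distrib using \<alpha>p(3) of_nat_0_le_iff by blast
    qed
    ultimately show ?thesis by (simp add: F_def algebra_simps)
  qed

  have cont_c: "continuous_on S c" for S
    unfolding c_def a_def using \<alpha> p by (intro continuous_intros) auto
  \<comment> \<open>The bound \<open>\<alpha> < x\<close> keeps the interval away from the pole of
    \<open>t\<close>.\<close>
  have cont_F: "continuous_on {x..L} (\<lambda>x. F x (s x))" if "\<alpha> < x" "continuous_on {x..L} s" for x s
    unfolding F_def t_def using that by (intro continuous_intros cont_c) auto

  \<comment> \<open>At \<open>\<alpha> * p\<close> the factor \<open>a\<close> vanishes, so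
    \<open>c\<close> equals \<open>-(q - 1) < 0\<close> there, while \<open>c L > 0\<close>.\<close>
  obtain x0 where x0: "\<alpha> * p \<le> x0" "x0 \<le> L" "c x0 = 0"
    using IVT'[of c "\<alpha> * p" 0 L] cont_c cL \<alpha>p assms(4) by (auto simp: c_def a_def L_def)
  have "x0 \<noteq> \<alpha> * p" using x0(3) assms(4) by (auto simp: c_def a_def)
  then have x0p: "\<alpha> * p < x0" "\<alpha> < x0" using x0 \<alpha>p by auto
  have "0 < (1 - \<alpha>) * t x0 ^ k" using x0p \<alpha> by (simp add: t_def)
  then have "F x0 1 < 0" using x0(3) x0p(1) by (simp add: F_def)
  then obtain x where x: "x0 \<le> x" "x \<le> L" "F x 1 = 0"
    using IVT'[of "\<lambda>x. F x 1" x0 0 L] cont_F[OF x0p(2), of "\<lambda>_. 1"] FL[of 1] x0(2) by auto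
  have "x \<noteq> x0" using x(3) \<open>F x0 1 < 0\<close> by auto
  then have x0x: "x0 < x" using x by simp
  have xp: "\<alpha> * p < x" "\<alpha> < x" using x0x x0p by auto
  have ax: "0 < a x" and tx: "0 < t x" using a_pos xp \<alpha> by (auto simp: t_def)
  have cx: "0 < c x"
  proof -
    \<comment> \<open>\<open>c\<close> is, up to constants, a product of two increasing positive
      factors to the right of \<open>x0\<close>, so it is positive beyond its zero
      \<open>x0\<close>.\<close>
    have "a x0 < a x" using x0x \<alpha> p by (simp add: a_def divide_strict_right_mono)
    then have "(x0 - \<alpha> * q) * a x0 < (x - \<alpha> * q) * a x"
      using x0x x0p \<alpha>p a_pos[OF x0p(1)] by (intro mult_strict_mono) auto
    then have "c x0 < c x" using \<alpha> by (simp add: c_def divide_strict_right_mono)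
    then show ?thesis using x0(3) by simp
  qed
  \<comment> \<open>This is the difference of the rows of \<open>p + 1\<close> and
    \<open>p + q\<close> in \<open>B2\<close>: on the right stands the contribution of the extra arc
    at \<open>p + 1\<close>, through the outdegree and through its head.\<close>
  have "(x - \<alpha> * p) * (c x - 1) = \<alpha> * c x + (1 - \<alpha>) * t x ^ k"
    using x(3) by (simp add: F_def algebra_simps)
  moreover have "0 < \<alpha> * c x + (1 - \<alpha>) * t x ^ k" using cx tx \<alpha> by (simp add: add_nonneg_pos)
  ultimately have "0 < (x - \<alpha> * p) * (c x - 1)" by (simp only:)
  then have c1: "1 < c x" using xp(1) by (simp add: zero_less_mult_iff)
  \<comment> \<open>\<open>F x\<close> is strictly decreasing in \<open>s\<close>, because
    \<open>t x > 0\<close>.\<close>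
  have "F x (c x) < F x 1" using c1 tx \<alpha> by (simp add: F_def)
  then have Fneg: "F x (c x) < 0" using x(3) by simp
  then obtain y where y: "x \<le> y" "y \<le> L" "F y (c y) = 0"
    using IVT'[of "\<lambda>x. F x (c x)" x 0 L] cont_F[OF xp(2), of c] cont_c FL[of "c L"] x(2) by auto
  have "x \<noteq> y" using y(3) Fneg by auto
  then have xy: "x < y" using y by simp

  have "lambda_alpha \<alpha> (B2 n p q) \<le> x"
    unfolding B2_eq_B_end[OF assms(4) n]
  proof (rule lambda_alpha_le[where f = "B_end_vector n p q (a x) (c x) (t x) 1"])
    show "\<alpha> * real (out_degree (B_end n p q (p + q)) u) * B_end_vector n p q (a x) (c x) (t x) 1 u
      + (1 - \<alpha>) * (\<Sum>w | w \<in> verts (B_end n p q (p + q)) \<and> u \<rightarrow>\<^bsub>B_end n p q (p + q)\<^esub> w.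
          B_end_vector n p q (a x) (c x) (t x) 1 w)
      \<le> x * B_end_vector n p q (a x) (c x) (t x) 1 u" if "u \<in> verts (B_end n p q (p + q))" for u
      using B_end_eigenvector[OF assms(4) n _ eq_a eq_1 eq_c[OF x(3), unfolded k_def] eq_t[OF xp(2)] that]
      by simp
  qed (use \<alpha> ax cx tx n in \<open>auto simp: B_end_def B_end_vector_def\<close>)
  also have "x < y" by (rule xy)
  also have "y \<le> lambda_alpha \<alpha> (B4 n p q)"
    unfolding B4_eq_B_end[OF assms(4) n]
  \<comment> \<open>As \<open>q \<ge> 2\<close>, the vertex \<open>p + 2\<close> lies in
    \<open>V_q\<close> and carries the entry \<open>1\<close>, so the vector is nonzero.\<close>
  proof (rule lambda_alpha_ge[where f = "B_end_vector n p q (a y) (c y) (t y) (c y)" and z = "p + 2"])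
    show "\<alpha> * real (out_degree (B_end n p q (p + 1)) u) * B_end_vector n p q (a y) (c y) (t y) (c y) u
      + (1 - \<alpha>) * (\<Sum>w | w \<in> verts (B_end n p q (p + 1)) \<and> u \<rightarrow>\<^bsub>B_end n p q (p + 1)\<^esub> w.
          B_end_vector n p q (a y) (c y) (t y) (c y) w)
      = y * B_end_vector n p q (a y) (c y) (t y) (c y) u" if "u \<in> verts (B_end n p q (p + 1))" for u
      using xy xp by (intro B_end_eigenvector[OF assms(4) n _ eq_a eq_1
        eq_c[OF y(3), unfolded k_def] eq_t that]) auto
  qed (use n assms(4) in \<open>auto simp: B_end_def B_end_vector_def\<close>)
  finally show ?thesis .
qed

end
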